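(* Let $k,n$ be positive integers and let $i$ be an integer with $0\le i<k$. In the maximum-strip case, the number of good paths is $$\frac{n(k-i)(k+1-i)}{(kn+n-1-i)(kn+n-i)}\binom{kn+n-i}{n}.$$
   Context: All paths are lattice paths in $\mathbb{Z}^2$ composed only of unit steps to the right $(1,0)$ and up $(0,1)$. Fix positive integers $k,n$ and an integer $i$ with $0\le i<k$. For a point $(x,y)$ let $d((x,y))=ky-x$, the signed horizontal distance from $(x,y)$ to the line $y=x/k$. In the maximum-strip case, the strip consists of all lattice points $p\notin\{(0,0),(kn-i,n)\}$ such that $0\le d(p)<i$, together with all lattice points in the interior of the upper boundary, i.e. all lattice points $p=(x,y)$ with $d(p)=i$ and $0<y<n$. Points in the strip are called forbidden. A good path is a path from $(0,0)$ to $(kn-i,n)$ that avoids all forbidden points. *)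

theory Defs
  imports Complex_Main
begin

definition unit_step :: "int \<times> int \<Rightarrow> int \<times> int \<Rightarrow> bool" where
  "unit_step p q \<longleftrightarrow> q = (fst p + 1, snd p) \<or> q = (fst p, snd p + 1)"

text \<open>A path is represented by the list of lattice points it visits, both endpoints included.\<close>

definition lattice_path :: "int \<times> int \<Rightarrow> int \<times> int \<Rightarrow> (int \<times> int) list \<Rightarrow> bool" where
  "lattice_path a b ps \<longleftrightarrow> ps \<noteq> [] \<and> hd ps = a \<and> last ps = b \<and> successively unit_step ps"

text \<open>The signed horizontal distance from a point to the line $y = x/k$.\<close>

definition hdist :: "nat \<Rightarrow> int \<times> int \<Rightarrow> int" where
  "hdist k p = int k * snd p - fst p"

definition end_point :: "nat \<Rightarrow> nat \<Rightarrow> nat \<Rightarrow> int \<times> int" where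
  "end_point k n i = (int k * int n - int i, int n)"

definition max_strip :: "nat \<Rightarrow> nat \<Rightarrow> nat \<Rightarrow> (int \<times> int) set" where
  "max_strip k n i =
     {p. p \<notin> {(0, 0), end_point k n i} \<and> 0 \<le> hdist k p \<and> hdist k p < int i}
     \<union> {p. hdist k p = int i \<and> 0 < snd p \<and> snd p < int n}"

definition good_paths :: "nat \<Rightarrow> nat \<Rightarrow> nat \<Rightarrow> (int \<times> int) list set" where
  "good_paths k n i =
     {ps. lattice_path (0, 0) (end_point k n i) ps \<and> set ps \<inter> max_strip k n i = {}}"

end

theory Submission
  imports Defs
begin

text \<open>
  Read a path as a word in up-steps (raising \<^const>\<open>hdist\<close> by $k$) and right-steps (lowering it by $1$).
  A good path can only enter the region above the strip by one up-step, from height $-j$ to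
  $k - j$ with $0 \<le> j \<le> k - i$. The part before this step, reversed, is a first passage down by $j$,
  and the part after it is a first passage down by $k - i - j$. Their concatenation is a first passage
  down by $k - i$ with $n - 1$ up-steps, and it can be cut back for every $j$. So the
  number of good paths is $k - i + 1$ times the number of such first passages, which is a
  Raney number.
\<close>

section \<open>First passage words\<close>

text \<open>\<open>True\<close> encodes an up-step and \<open>False\<close> a right-step, so heights
  of words follow \<open>hdist\<close> along paths.\<close>

definition step_height :: "nat \<Rightarrow> bool \<Rightarrow> int" where
  "step_height k b = (if b then int k else -1)"

definition height :: "nat \<Rightarrow> bool list \<Rightarrow> int" where
  "height k w = (\<Sum>b\<leftarrow>w. step_height k b)"

lemma height_simps [simp]:
  "height k [] = 0"
  "height k (b # w) = step_height k b + height k w"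
  "height k (u @ w) = height k u + height k w"
  "height k (rev w) = height k w"
  by (simp_all add: height_def flip: rev_map)

lemma step_height_ge: "step_height k b \<ge> -1"
  by (simp add: step_height_def)

text \<open>\<open>h\<close> is the remaining height above level 0, tested before each letter, so
  that 0 is met only at the very end. As an integer it may become negative, and then no word
  qualifies.\<close>

primrec first_passage :: "nat \<Rightarrow> int \<Rightarrow> bool list \<Rightarrow> bool" where
  "first_passage k h [] \<longleftrightarrow> h = 0"
| "first_passage k h (b # w) \<longleftrightarrow> 0 < h \<and> first_passage k (h + step_height k b) w"

lemma first_passage_height: "first_passage k h w \<Longrightarrow> height k w = - h"
  by (induction w arbitrary: h) fastforce+

lemma first_passage_nonneg: "first_passage k h w \<Longrightarrow> 0 \<le> h"
  by (cases w) auto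

lemma first_passage_0_iff [simp]: "first_passage k 0 w \<longleftrightarrow> w = []"
  by (cases w) auto

lemma first_passage_iff:
  "first_passage k h w \<longleftrightarrow>
     h + height k w = 0 \<and> (\<forall>t<length w. 0 < h + height k (take t w))"
proof (induction w arbitrary: h)
  case (Cons b w)
  show ?case
    by (simp add: Cons.IH All_less_Suc2 add.assoc) auto
qed simp

text \<open>Raised by \<open>l\<close>, which is nonnegative, the word \<open>u\<close> stays
  positive and ends at \<open>l\<close>, where \<open>w\<close> takes over.\<close>

lemma first_passage_append:
  assumes "first_passage k h u" "first_passage k l w"
  shows "first_passage k (h + l) (u @ w)"
  using assms(1)
proof (induction u arbitrary: h)
  case Nil
  then show ?case using assms(2) by simp
next
  case (Cons b u)
  then have "first_passage k (h + step_height k b + l) (u @ w)" by simp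
  then show ?case
    using Cons.prems first_passage_nonneg[OF assms(2)] by (simp add: algebra_simps)
qed

text \<open>Descents have size 1, so no level is skipped on the way down: the cut is at the first
  visit to level \<open>h - j\<close>.\<close>

lemma first_passage_split:
  assumes "first_passage k h w" "0 \<le> j" "j \<le> h"
  shows "\<exists>u v. w = u @ v \<and> first_passage k j u \<and> first_passage k (h - j) v"
  using assms
proof (induction w arbitrary: h j)
  case (Cons b w)
  show ?case
  proof (cases "j = 0")
    case True
    then show ?thesis using Cons.prems by force
  next
    case False
    then have "0 \<le> j + step_height k b"
      using Cons.prems step_height_ge[of k b] by linarith
    then obtain u v where "w = u @ v" "first_passage k (j + step_height k b) u"
      "first_passage k (h - j) v"
      using Cons.IH[of "h + step_height k b" "j + step_height k b"] Cons.prems by auto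
    then have "b # w = (b # u) @ v \<and> first_passage k j (b # u) \<and> first_passage k (h - j) v"
      using False Cons.prems by auto
    then show ?thesis by blast
  qed
qed simp

text \<open>A first passage stops at its first visit to 0, and this visit can be read off from any
  word that extends it.\<close>

lemma first_passage_prefix_free:
  assumes "first_passage k h u" "first_passage k h u'" "u @ v = u' @ v'"
  shows "u = u'"
  using assms
proof (induction u arbitrary: h u')
  case (Cons b u)
  then show ?case by (cases u') auto
qed simp

section \<open>Counting first passages by Raney numbers\<close>

definition first_passages :: "nat \<Rightarrow> nat \<Rightarrow> nat \<Rightarrow> bool list set" where
  "first_passages k h m = {w. first_passage k (int h) w \<and> count_list w True = m}"

lemma first_passages_0: "first_passages k 0 m = (if m = 0 then {[]} else {})"
  by (auto simp: first_passages_def)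

lemma first_passages_Suc:
  "first_passages k (Suc h) 0 = (#) False ` first_passages k h 0"
  "first_passages k (Suc h) (Suc m) =
     (#) False ` first_passages k h (Suc m) \<union> (#) True ` first_passages k (Suc h + k) m"
proof -
  have *: "w \<in> first_passages k (Suc h) m \<longleftrightarrow>
      (\<exists>v. w = False # v \<and> v \<in> first_passages k h m) \<or>
      (\<exists>v m'. w = True # v \<and> m = Suc m' \<and> v \<in> first_passages k (Suc h + k) m')" for w m
    by (cases w) (auto simp: first_passages_def step_height_def algebra_simps)
  show "first_passages k (Suc h) 0 = (#) False ` first_passages k h 0"
    "first_passages k (Suc h) (Suc m) =
     (#) False ` first_passages k h (Suc m) \<union> (#) True ` first_passages k (Suc h + k) m"
    by (auto simp: *)
qed

text \<open>The arithmetic of the induction step: \<open>x\<close> and \<open>y\<close> stand for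
  the numbers of words starting with a right-step and with an up-step, and \<open>L\<close> is the
  common length of what remains after that letter.\<close>

lemma raney_recurrence:
  assumes L: "L = m * (k + 1) + h + k + 1"
    and x: "L * x = h * (L choose Suc m)"
    and y: "L * y = (Suc h + k) * (L choose m)"
  shows "Suc L * (x + y) = Suc h * (Suc L choose Suc m)"
proof -
  let ?C = "Suc L choose Suc m"
  have up: "Suc L * (L choose m) = Suc m * ?C"
    by (metis Suc_times_binomial_eq mult.commute)
  have "Suc L * (L choose Suc m) + Suc L * (L choose m) = Suc L * ?C"
    by (simp add: algebra_simps)
  \<comment> \<open>Over the integers \<open>L - m\<close> is a true difference.\<close>
  then have right: "int (Suc L * (L choose Suc m)) = (int L - int m) * int ?C"
    unfolding up by (simp add: algebra_simps flip: of_nat_add of_nat_mult)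
  have "int L * int (Suc L * (x + y))
      = int h * int (Suc L * (L choose Suc m)) + int (Suc h + k) * int (Suc L * (L choose m))"
  proof -
    have "L * (Suc L * (x + y)) = Suc L * (L * x) + Suc L * (L * y)"
      by (simp add: algebra_simps)
    also have "\<dots> = h * (Suc L * (L choose Suc m)) + (Suc h + k) * (Suc L * (L choose m))"
      unfolding x y by (simp only: ac_simps)
    finally show ?thesis by (metis of_nat_add of_nat_mult)
  qed
  also have "\<dots> = (int h * (int L - int m) + (int h + 1 + int k) * (int m + 1)) * int ?C"
    unfolding up right by (simp add: algebra_simps)
  \<comment> \<open>Here the value of \<open>L\<close> enters: the terms in \<open>h * m\<close>
    cancel, and the rest is \<open>h * L + L\<close>.\<close>
  also have "int h * (int L - int m) + (int h + 1 + int k) * (int m + 1) = int L * (int h + 1)"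
    using L by (simp add: algebra_simps)
  finally have "int L * int (Suc L * (x + y)) = int L * int (Suc h * ?C)"
    by (simp add: algebra_simps)
  moreover have "L > 0" using L by simp
  ultimately show ?thesis
    by (metis mult_cancel1 of_nat_eq_iff of_nat_mult not_gr_zero)
qed

text \<open>Induction on the word length \<open>m * (k + 1) + h\<close>, splitting off the first
  letter. The product form avoids division and also covers length 0; finiteness is carried along to
  make cardinalities add up.\<close>

lemma card_first_passages:
  "finite (first_passages k h m) \<and>
    (m * (k + 1) + h) * card (first_passages k h m) = h * ((m * (k + 1) + h) choose m)"
proof (induction "m * (k + 1) + h" arbitrary: h m rule: less_induct)
  case less
  show ?case
  proof (cases h)
    case 0
    then show ?thesis by (simp add: first_passages_0)
  next
    case (Suc h')
    show ?thesis
    proof (cases m)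
      case 0
      have IH: "finite (first_passages k h' 0)" "h' * card (first_passages k h' 0) = h'"
        using less[of 0 h'] 0 Suc by auto
      \<comment> \<open>For \<open>h' = 0\<close> the induction hypothesis only says
        \<open>0 = 0\<close>, so the explicit set is used.\<close>
      have "card (first_passages k h' 0) = 1"
        using IH by (cases "h' = 0") (simp_all add: first_passages_0)
      then show ?thesis
        using 0 Suc IH(1) by (simp add: first_passages_Suc card_image)
    next
      case m: (Suc m')
      define L where "L = m' * (k + 1) + h' + k + 1"
      have L: "m * (k + 1) + h' = L" "m' * (k + 1) + (Suc h' + k) = L" "m * (k + 1) + h = Suc L"
        by (simp_all add: L_def m Suc algebra_simps)
      have IH1: "finite (first_passages k h' m)"
          "L * card (first_passages k h' m) = h' * (L choose m)"
        using less[of m h'] L by auto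
      have IH2: "finite (first_passages k (Suc h' + k) m')"
          "L * card (first_passages k (Suc h' + k) m') = (Suc h' + k) * (L choose m')"
        using less[of m' "Suc h' + k"] unfolding L by auto
      have split: "first_passages k h m =
          (#) False ` first_passages k h' m \<union> (#) True ` first_passages k (Suc h' + k) m'"
        unfolding Suc m by (rule first_passages_Suc)
      have "card (first_passages k h m) =
          card (first_passages k h' m) + card (first_passages k (Suc h' + k) m')"
        unfolding split using IH1(1) IH2(1)
        by (subst card_Un_disjoint) (auto simp: card_image)
      moreover have "finite (first_passages k h m)"
        unfolding split using IH1(1) IH2(1) by blast
      ultimately show ?thesis
        using raney_recurrence[OF L_def IH1(2)[unfolded m] IH2(2)]
        unfolding L by (simp only: m Suc)
    qed
  qed
qed

section \<open>Good words\<close>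

text \<open>Both ends of the word are exempt, since their heights 0 and \<open>i\<close> lie in the
  forbidden interval.\<close>

definition good_words :: "nat \<Rightarrow> nat \<Rightarrow> nat \<Rightarrow> bool list set" where
  "good_words k n i = {w. height k w = int i \<and> count_list w True = n \<and>
     (\<forall>t. 0 < t \<and> t < length w \<longrightarrow> height k (take t w) \<notin> {0..int i})}"

text \<open>Models a good word cut at its crossing step: \<open>u\<close> is the part before it read
  backwards, \<open>v\<close> the part after it, and the crossing starts at height
  \<open>-j\<close>.\<close>

definition passage_pairs :: "nat \<Rightarrow> nat \<Rightarrow> nat \<Rightarrow> (bool list \<times> bool list) set" where
  "passage_pairs k h m = {(u, v). \<exists>j\<in>{0..int h}. first_passage k j u \<and>
     first_passage k (int h - j) v \<and> count_list u True + count_list v True = m}"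

text \<open>The level \<open>j\<close> is \<open>- height k u\<close>; with it, prefix-freeness
  recovers the cut from the concatenation. Each first passage thus arises once for each of the
  \<open>h + 1\<close> levels.\<close>

lemma bij_betw_passage_pairs:
  "bij_betw (\<lambda>(u, v). (- height k u, u @ v)) (passage_pairs k h m)
     ({0..int h} \<times> first_passages k h m)"
proof (rule bij_betwI')
  fix p q assume p: "p \<in> passage_pairs k h m" and q: "q \<in> passage_pairs k h m"
  obtain u v u' v' where pq: "p = (u, v)" "q = (u', v')" by fastforce
  have "first_passage k (- height k u) u" "first_passage k (- height k u') u'"
    using p q by (auto simp: passage_pairs_def pq) (metis first_passage_height minus_minus)+
  then have "u = u'" if "height k u = height k u'" "u @ v = u' @ v'"
    using that first_passage_prefix_free by metis
  then show "((\<lambda>(u, v). (- height k u, u @ v)) p = (\<lambda>(u, v). (- height k u, u @ v)) q) = (p = q)"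
    by (auto simp: pq)
next
  fix p assume "p \<in> passage_pairs k h m"
  then obtain u v j where p: "p = (u, v)" "0 \<le> j" "j \<le> int h" "first_passage k j u"
    "first_passage k (int h - j) v" "count_list u True + count_list v True = m"
    by (auto simp: passage_pairs_def)
  then have "first_passage k (int h) (u @ v)"
    using first_passage_append[of k j u "int h - j" v] by simp
  then show "(\<lambda>(u, v). (- height k u, u @ v)) p \<in> {0..int h} \<times> first_passages k h m"
    using p first_passage_height by (simp add: first_passages_def)
next
  fix q assume "q \<in> {0..int h} \<times> first_passages k h m"
  then obtain j w where q: "q = (j, w)" "0 \<le> j" "j \<le> int h" "first_passage k (int h) w"
    "count_list w True = m"
    by (auto simp: first_passages_def)
  then obtain u v where w: "w = u @ v" "first_passage k j u" "first_passage k (int h - j) v"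
    using first_passage_split by blast
  then have "(u, v) \<in> passage_pairs k h m"
    using q by (auto simp: passage_pairs_def)
  moreover have "q = (- height k u, u @ v)"
    using q w first_passage_height by simp
  ultimately show "\<exists>p\<in>passage_pairs k h m. q = (\<lambda>(u, v). (- height k u, u @ v)) p"
    by force
qed

section \<open>Cutting a good word at its crossing step\<close>

text \<open>A prefix of \<open>rev u\<close> is a reversed suffix of \<open>u\<close>, whose height
  is the total minus that of the complementary prefix. Positivity before the end thus becomes
  negativity after the start.\<close>

lemma first_passage_rev_iff:
  "first_passage k j (rev u) \<longleftrightarrow>
     j + height k u = 0 \<and> (\<forall>t. 0 < t \<and> t \<le> length u \<longrightarrow> height k (take t u) < 0)"
proof -
  have drop: "height k (drop t u) = height k u - height k (take t u)" for t
    using height_simps(3)[of k "take t u" "drop t u"] by simp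
  have "(\<forall>t<length u. P (length u - t)) \<longleftrightarrow> (\<forall>t. 0 < t \<and> t \<le> length u \<longrightarrow> P t)" for P
  proof (intro iffI allI impI)
    fix t assume "\<forall>t<length u. P (length u - t)" "0 < t \<and> t \<le> length u"
    then show "P t" by (metis diff_diff_cancel diff_less less_le_trans)
  qed simp
  from this[of "\<lambda>t. 0 < j + height k (drop t u)"] show ?thesis
    unfolding first_passage_iff by (auto simp: take_rev drop) (smt (verit))+
qed

lemma good_word_of_passage_pair:
  assumes "i \<le> k" "0 < n" "(u, v) \<in> passage_pairs k (k - i) (n - 1)"
  shows "rev u @ True # v \<in> good_words k n i"
proof -
  from assms(3) obtain j where j: "0 \<le> j" "j \<le> int k - int i" "first_passage k j u"
    "first_passage k (int k - int i - j) v" "count_list u True + count_list v True = n - 1"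
    using assms(1) by (auto simp: passage_pairs_def of_nat_diff)
  have hu: "height k u = - j" and hv: "height k v = - (int k - int i - j)"
    using j first_passage_height by blast+
  have u: "height k (take t (rev u)) < 0" if "0 < t" "t \<le> length u" for t
    using j(3) that first_passage_rev_iff[of k j "rev u"] by simp
  have v: "0 < int k - int i - j + height k (take t v)" if "t < length v" for t
    using j(4) that unfolding first_passage_iff by blast
  have "height k (take t (rev u @ True # v)) \<notin> {0..int i}"
    if "0 < t" "t < length (rev u @ True # v)" for t
  proof (cases "t \<le> length u")
    case True
    then show ?thesis using u[of t] that by simp
  next
    case False
    \<comment> \<open>The prefix contains the crossing step and \<open>s\<close> letters of
      \<open>v\<close>, so its height exceeds \<open>i\<close>.\<close>
    then obtain s where "t = length u + Suc s"
      using less_imp_Suc_add by (metis add_Suc_right not_le)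
    then show ?thesis
      using v[of s] that hu by (simp add: step_height_def)
  qed
  moreover have "count_list (rev u @ True # v) True = n"
    using j(5) assms(2) by (simp add: count_list_append)
  ultimately show ?thesis
    using hu hv unfolding good_words_def by (simp add: step_height_def)
qed

text \<open>Right-steps descend by 1, so the strip cannot be jumped over downwards; level
  \<open>i\<close> is met only at the end. The case \<open>c = i\<close> forces \<open>v\<close> to
  be empty.\<close>

lemma first_passage_above_strip:
  assumes "c + height k v = int i" "int i \<le> c"
    "\<And>t. t < length v \<Longrightarrow> c + height k (take t v) \<notin> {0..int i}"
  shows "first_passage k (c - int i) v"
  using assms
proof (induction v arbitrary: c)
  case (Cons b v)
  have c: "int i < c" using Cons.prems(2) Cons.prems(3)[of 0] by simp
  have "first_passage k (c + step_height k b - int i) v"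
  proof (rule Cons.IH)
    show "int i \<le> c + step_height k b" using c step_height_ge[of k b] by linarith
    show "c + step_height k b + height k (take t v) \<notin> {0..int i}" if "t < length v" for t
      using Cons.prems(3)[of "Suc t"] that by (simp add: add.assoc)
  qed (use Cons.prems(1) in simp)
  then show ?case using c by (simp add: algebra_simps)
qed simp

lemma passage_pair_of_good_word:
  assumes "i \<le> k" "0 < n" "w \<in> good_words k n i"
  shows "\<exists>(u, v) \<in> passage_pairs k (k - i) (n - 1). w = rev u @ True # v"
proof -
  have h: "height k w = int i" and cw: "count_list w True = n"
    and avoid: "\<And>t. 0 < t \<Longrightarrow> t < length w \<Longrightarrow> height k (take t w) \<notin> {0..int i}"
    using assms(3) by (auto simp: good_words_def)
  have "w \<noteq> []" using cw assms(2) by auto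
  \<comment> \<open>The crossing is the first step that ends at height at least 0. The last step
    ends at \<open>i\<close>, so such a step exists.\<close>
  define P where "P s \<longleftrightarrow> s < length w \<and> 0 \<le> height k (take (Suc s) w)" for s
  define s where "s = (LEAST s. P s)"
  have "P (length w - 1)" using \<open>w \<noteq> []\<close> h by (simp add: P_def)
  then have "P s" unfolding s_def by (rule LeastI)
  then have s: "s < length w" "0 \<le> height k (take (Suc s) w)" by (auto simp: P_def)
  have below: "height k (take t w) < 0" if t: "0 < t" "t \<le> s" for t
  proof -
    have "\<not> P (t - 1)" using t unfolding s_def by (intro not_less_Least) simp
    then show ?thesis using t s(1) by (cases t) (simp_all add: P_def)
  qed
  define u v where "u = take s w" and "v = drop (Suc s) w"
  have lu: "length u = s" using s(1) by (simp add: u_def)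
  have take_Suc: "take (Suc s) w = u @ [w ! s]"
    using s(1) by (simp add: take_Suc_conv_app_nth u_def)
  have hu: "height k u \<le> 0" using below[of s] by (cases "s = 0") (auto simp: u_def)
  \<comment> \<open>A right-step from height at most 0 would end below 0.\<close>
  have "w ! s"
  proof (rule ccontr)
    assume "\<not> w ! s"
    then show False
      using s(2)[unfolded take_Suc] hu by (simp add: step_height_def)
  qed
  then have w: "w = u @ True # v"
    using s(1) id_take_nth_drop[of s w] by (simp add: u_def v_def)
  have c: "0 \<le> height k u + int k" using s(2) \<open>w ! s\<close> by (simp add: take_Suc step_height_def)
  have avoid_v: "height k u + int k + height k (take t v) \<notin> {0..int i}" if "t < length v" for t
    using avoid[of "s + Suc t"] that lu by (simp add: w step_height_def add.assoc)
  have end_v: "height k u + int k + height k v = int i"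
    using h by (simp add: w step_height_def)
  \<comment> \<open>If \<open>v\<close> is empty, the crossing ends the word at height
    \<open>i\<close>; otherwise avoidance right after the crossing pushes it above the
    strip.\<close>
  have above: "int i \<le> height k u + int k"
    using c avoid_v[of 0] end_v by (cases v) auto
  have "first_passage k (height k u + int k - int i) v"
    using end_v above avoid_v by (rule first_passage_above_strip)
  moreover have "first_passage k (- height k u) (rev u)"
    unfolding first_passage_rev_iff using below s(1) by (auto simp: u_def min_def)
  moreover have "count_list (rev u) True + count_list v True = n - 1"
    using cw by (simp add: w)
  ultimately have "(rev u, v) \<in> passage_pairs k (k - i) (n - 1)"
    using hu above assms(1) unfolding passage_pairs_def
    by (auto simp: of_nat_diff algebra_simps intro!: bexI[of _ "- height k u"])
  then show ?thesis using w by force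
qed

text \<open>If \<open>u'\<close> were longer, the crossing of the first word would lie inside
  \<open>rev u'\<close>, where heights are negative, yet it ends at a nonnegative height. Applied
  both ways, this gives equal lengths.\<close>

lemma crossing_unique:
  assumes "i \<le> k" "(u, v) \<in> passage_pairs k (k - i) m" "(u', v') \<in> passage_pairs k (k - i) m"
    and eq: "rev u @ True # v = rev u' @ True # v'"
  shows "length u' \<le> length u"
proof (rule ccontr)
  assume "\<not> length u' \<le> length u"
  then have less: "length u < length u'" by simp
  have "take (Suc (length u)) (rev u') = take (Suc (length u)) (rev u' @ True # v')"
    using less by simp
  also have "\<dots> = rev u @ [True]" by (simp flip: eq)
  finally have *: "take (Suc (length u)) (rev u') = rev u @ [True]" .
  have "height k (take (Suc (length u)) (rev u')) < 0"
    using assms(3) less first_passage_rev_iff[of k _ "rev u'"] by (auto simp: passage_pairs_def)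
  moreover have "0 \<le> height k u + int k"
    using assms(1,2) by (auto simp: passage_pairs_def of_nat_diff dest!: first_passage_height)
  ultimately show False unfolding * by (simp add: step_height_def)
qed

lemma bij_betw_good_words:
  assumes "i \<le> k" "0 < n"
  shows "bij_betw (\<lambda>(u, v). rev u @ True # v) (passage_pairs k (k - i) (n - 1)) (good_words k n i)"
  unfolding bij_betw_def
proof
  show "inj_on (\<lambda>(u, v). rev u @ True # v) (passage_pairs k (k - i) (n - 1))"
  proof (rule inj_onI, clarify)
    fix u v u' v'
    assume *: "(u, v) \<in> passage_pairs k (k - i) (n - 1)" "(u', v') \<in> passage_pairs k (k - i) (n - 1)"
      "rev u @ True # v = rev u' @ True # v'"
    then have "length u = length u'"
      using crossing_unique[OF assms(1)] by (metis le_antisym)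
    then show "u = u' \<and> v = v'" using *(3) by simp
  qed
  show "(\<lambda>(u, v). rev u @ True # v) ` passage_pairs k (k - i) (n - 1) = good_words k n i"
    using good_word_of_passage_pair[OF assms] passage_pair_of_good_word[OF assms] by fast
qed

lemma card_good_words:
  assumes "i \<le> k" "0 < n"
  shows "card (good_words k n i) = (k - i + 1) * card (first_passages k (k - i) (n - 1))"
  using bij_betw_same_card[OF bij_betw_good_words[OF assms]]
    bij_betw_same_card[OF bij_betw_passage_pairs[of k "k - i" "n - 1"]]
  by (simp add: card_cartesian_product nat_add_distrib)

section \<open>Paths as words\<close>

definition move :: "int \<times> int \<Rightarrow> bool \<Rightarrow> int \<times> int" where
  "move p b = (if b then (fst p, snd p + 1) else (fst p + 1, snd p))"

primrec trace :: "int \<times> int \<Rightarrow> bool list \<Rightarrow> (int \<times> int) list" where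
  "trace p [] = [p]"
| "trace p (b # w) = p # trace (move p b) w"

lemma unit_step_iff_move: "unit_step p q \<longleftrightarrow> (\<exists>b. q = move p b)"
  by (auto simp: unit_step_def move_def)

lemma trace_neq_Nil [simp]: "trace p w \<noteq> []"
  by (cases w) auto

lemma hd_trace [simp]: "hd (trace p w) = p"
  by (cases w) auto

lemma last_trace [simp]: "last (trace p w) = foldl move p w"
  by (induction w arbitrary: p) auto

lemma successively_trace: "successively unit_step (trace p w)"
  by (induction w arbitrary: p) (auto simp: successively_Cons unit_step_iff_move)

lemma set_trace: "set (trace p w) = (\<lambda>t. foldl move p (take t w)) ` {..length w}"
proof (induction w arbitrary: p)
  case (Cons b w)
  show ?case by (simp add: Cons.IH atMost_Suc_eq_insert_0 image_image)
qed simp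

text \<open>The second visited point reveals the first letter. Hence counting paths amounts to
  counting words.\<close>

lemma inj_trace: "inj (trace p)"
proof (rule injI)
  fix w w' show "trace p w = trace p w' \<Longrightarrow> w = w'"
  proof (induction w arbitrary: p w')
    case Nil
    then show ?case by (cases w') (auto dest: sym)
  next
    case (Cons b w)
    then obtain b' v where w': "w' = b' # v" by (cases w') auto
    then have eq: "trace (move p b) w = trace (move p b') v" using Cons.prems by simp
    then have "move p b = move p b'" by (metis hd_trace)
    then have "b = b'" by (auto simp: move_def split: if_splits)
    then show ?case using eq Cons.IH w' by simp
  qed
qed

lemma successively_unit_stepE:
  assumes "successively unit_step ps" "ps \<noteq> []"
  shows "\<exists>w. ps = trace (hd ps) w"
  using assms
proof (induction ps)
  case (Cons p ps)
  show ?case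
  proof (cases "ps = []")
    case True
    then show ?thesis by (auto intro: exI[of _ "[]"])
  next
    case False
    then obtain w b where "ps = trace (hd ps) w" "hd ps = move p b"
      using Cons by (auto simp: successively_Cons unit_step_iff_move)
    then have "p # ps = trace p (b # w)" by simp
    then show ?thesis by (metis list.sel(1))
  qed
qed simp

lemma lattice_path_iff_trace:
  "lattice_path p q ps \<longleftrightarrow> (\<exists>w. ps = trace p w \<and> foldl move p w = q)"
  unfolding lattice_path_def
  using successively_unit_stepE successively_trace by (metis hd_trace last_trace trace_neq_Nil)

section \<open>Coordinates of path points and the strip\<close>

lemma hdist_foldl_move: "hdist k (foldl move p w) = hdist k p + height k w"
proof (induction w arbitrary: p)
  case (Cons b w)
  have "hdist k (move p b) = hdist k p + step_height k b"
    by (simp add: hdist_def move_def step_height_def algebra_simps)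
  then show ?case by (simp add: Cons.IH)
qed simp

lemma snd_foldl_move: "snd (foldl move p w) = snd p + int (count_list w True)"
  by (induction w arbitrary: p) (auto simp: move_def)

lemma fst_foldl_move: "fst (foldl move p w) = fst p + (int (length w) - int (count_list w True))"
  by (induction w arbitrary: p) (auto simp: move_def)

text \<open>Replaces Cartesian coordinates by the two quantities that words control: height and
  number of up-steps.\<close>

lemma eq_end_point_iff: "p = end_point k n i \<longleftrightarrow> hdist k p = int i \<and> snd p = int n"
  by (cases p) (auto simp: end_point_def hdist_def)

text \<open>At interior times the exemption of the end points and the bounds on \<open>snd p\<close>
  hold automatically, so the two pieces of the strip merge into the height interval
  \<open>{0..int i}\<close>.\<close>

lemma trace_avoids_max_strip_iff:
  assumes "foldl move (0, 0) w = end_point k n i"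
  shows "set (trace (0, 0) w) \<inter> max_strip k n i = {} \<longleftrightarrow>
    (\<forall>t. 0 < t \<and> t < length w \<longrightarrow> height k (take t w) \<notin> {0..int i})"
proof -
  let ?p = "\<lambda>t. foldl move (0, 0) (take t w)"
  have hd: "hdist k (?p t) = height k (take t w)" for t
    by (simp add: hdist_foldl_move) (simp add: hdist_def)
  have inner: "?p t \<in> max_strip k n i \<longleftrightarrow> height k (take t w) \<in> {0..int i}"
    if t: "0 < t" "t < length w" for t
  proof -
    \<comment> \<open>Each step raises the coordinate sum by 1, so no interior point equals an end
      point.\<close>
    have sum: "fst (?p t) + snd (?p t) = int t"
      using t by (simp add: fst_foldl_move snd_foldl_move)
    have N: "fst (end_point k n i) + snd (end_point k n i) = int (length w)"
      unfolding assms[symmetric] by (simp add: fst_foldl_move snd_foldl_move)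
    have no: "?p t \<noteq> (0, 0)" "?p t \<noteq> end_point k n i"
      using sum N t by auto
    have "count_list w True = count_list (take t w) True + count_list (drop t w) True"
      by (metis append_take_drop_id count_list_append)
    then have "snd (?p t) \<le> snd (foldl move (0, 0) w)" by (simp add: snd_foldl_move)
    then have le: "snd (?p t) \<le> int n" by (simp add: assms end_point_def)
    have ge: "0 \<le> snd (?p t)" "0 \<le> fst (?p t)"
      using count_le_length[of "take t w" True] by (simp_all add: snd_foldl_move fst_foldl_move)
    have "0 < snd (?p t) \<and> snd (?p t) < int n" if "height k (take t w) = int i"
    proof -
      have "snd (?p t) \<noteq> int n" using no(2) that hd by (simp add: eq_end_point_iff)
      \<comment> \<open>On the axis the height is \<open>- fst (?p t)\<close>, at most 0; being
        \<open>i\<close>, it is 0, which puts the point at the origin and contradicts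
        \<open>0 < t\<close>.\<close>
      moreover have "snd (?p t) \<noteq> 0"
        using that sum t ge unfolding hd[symmetric] by (auto simp: hdist_def)
      ultimately show ?thesis using le ge by simp
    qed
    then show ?thesis using no by (auto simp: max_strip_def hd)
  qed
  have ends: "?p t \<notin> max_strip k n i" if "t = 0 \<or> t = length w" for t
    using that assms by (auto simp: max_strip_def end_point_def)
  have "set (trace (0, 0) w) \<inter> max_strip k n i = {} \<longleftrightarrow>
      (\<forall>t\<le>length w. ?p t \<notin> max_strip k n i)"
    unfolding set_trace by blast
  also have "\<dots> \<longleftrightarrow> (\<forall>t. 0 < t \<and> t < length w \<longrightarrow> ?p t \<notin> max_strip k n i)"
    using ends by (metis gr0I le_neq_implies_less less_imp_le)
  also have "\<dots> \<longleftrightarrow> (\<forall>t. 0 < t \<and> t < length w \<longrightarrow> height k (take t w) \<notin> {0..int i})"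
    using inner by blast
  finally show ?thesis .
qed

lemma good_paths_eq_trace_good_words: "good_paths k n i = trace (0, 0) ` good_words k n i"
proof -
  have end_iff: "foldl move (0, 0) w = end_point k n i \<longleftrightarrow>
      height k w = int i \<and> count_list w True = n" for w
    by (simp add: eq_end_point_iff hdist_foldl_move snd_foldl_move) (simp add: hdist_def)
  have "w \<in> good_words k n i \<longleftrightarrow> foldl move (0, 0) w = end_point k n i \<and>
      set (trace (0, 0) w) \<inter> max_strip k n i = {}" for w
    unfolding good_words_def mem_Collect_eq
    using trace_avoids_max_strip_iff[of w k n i] end_iff[of w] by blast
  then show ?thesis
    unfolding good_paths_def lattice_path_iff_trace by auto
qed

theorem theorem7:
  fixes k n i :: nat
  assumes "0 < k" and "0 < n" and "i < k"
  shows "real (card (good_paths k n i)) =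
    (real n * (real k - real i) * (real k + 1 - real i))
      / ((real k * real n + real n - 1 - real i) * (real k * real n + real n - real i))
      * real ((k * n + n - i) choose n)"
proof -
  obtain m where n: "n = Suc m" using assms(2) gr0_implies_Suc by blast
  obtain h where k: "k = i + h" and h: "0 < h" using assms(3) less_imp_add_positive by blast
  \<comment> \<open>The length of the first passages; the factors in the denominator are
    \<open>L\<close> and \<open>Suc L\<close>.\<close>
  define L where "L = m * (k + 1) + h"
  let ?F = "card (first_passages k h m)"
  have L: "k * n + n - i = Suc L" by (simp add: L_def n k algebra_simps)
  have "0 < L" using h by (simp add: L_def)
  have "card (good_paths k n i) = card (good_words k n i)"
    unfolding good_paths_eq_trace_good_words using inj_trace by (metis card_image inj_on_subset subset_UNIV)
  also have "\<dots> = (h + 1) * ?F" using card_good_words[of i k n] assms by (simp add: n k)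
  finally have card: "card (good_paths k n i) = (h + 1) * ?F" .
  have "L * ?F = h * (L choose m)"
    using card_first_passages[of k h m] by (simp only: L_def)
  \<comment> \<open>Absorption passes from \<open>m\<close> to \<open>n\<close> up-steps and
    produces the factor \<open>n\<close>.\<close>
  moreover have "Suc L * (L choose m) = n * (Suc L choose n)"
    unfolding n by (metis Suc_times_binomial_eq mult.commute)
  ultimately have "Suc L * (L * ?F) = h * (n * (Suc L choose n))"
    by (metis mult.left_commute)
  then have "real (Suc L) * (real L * real ?F) = real h * (real n * real (Suc L choose n))"
    by (metis of_nat_mult)
  then have F: "real ?F = real h * real n * real (Suc L choose n) / (real L * real (Suc L))"
    using \<open>0 < L\<close> by (simp add: field_simps del: of_nat_Suc)
  have "real (k * n + n) - real i = real (Suc L)"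
    unfolding L[symmetric] using assms by (subst of_nat_diff) (simp_all add: n)
  then have denom: "real k * real n + real n - real i = real (Suc L)"
    "real k * real n + real n - 1 - real i = real L"
    by simp_all
  have num: "real k - real i = real h" "real k + 1 - real i = real h + 1"
    by (simp_all add: k)
  show ?thesis
    unfolding card L denom num by (simp add: F add_divide_distrib algebra_simps del: of_nat_Suc)
qed

end
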